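(* Let $T\in G$ be a self-adjoint element, written as $T=e^{i\theta}\begin{bmatrix} UA & U(\xi)\\ \langle\cdot,\xi\rangle & a\end{bmatrix}$, where $\theta\in\mathbb{R}$, $\xi\in H$ with $\xi\neq0$, $a=\sqrt{1+\|\xi\|^2}$, $U$ is a unitary operator on $H$, and $A$ is the positive operator on $H$ with $A(\xi)=a\xi$ and $A=I$ on $\langle\xi\rangle^{\perp}$. Then: (1) $T$ is of the form $\pm\begin{bmatrix} UA & \xi\\ \langle\cdot,\xi\rangle & a\end{bmatrix}$, where $U$ is a unitary and involutory operator. (2) $\sigma(T)=\{a\pm\|\xi\|\}\cup\{\pm1\}$.
   Context: $H$ is an infinite-dimensional complex Hilbert space with inner product $\langle\cdot,\cdot\rangle$ linear in the first variable. On $H\oplus\mathbb{C}$ consider the sesquilinear form $\mathcal{A}((x,\lambda),(y,\mu))=\langle x,y\rangle-\lambda\overline{\mu}$. $G$ is the group of all bijective linear operators on $H\oplus\mathbb{C}$ leaving $\mathcal{A}$ invariant; every element of $G$ has the displayed form with some $\xi\in H$. A block matrix $\begin{bmatrix} P & \eta\\ \langle\cdot,\zeta\rangle & c\end{bmatrix}$ denotes the operator $(x,z)\mapsto (P(x)+z\eta,\ \langle x,\zeta\rangle+cz)$ on $H\oplus\mathbb{C}$. Self-adjoint refers to the Hilbert space $H\oplus\mathbb{C}$ with its usual inner product. An operator $U$ is involutory if $U^2=I$. $\langle\xi\rangle$ is the linear span of $\xi$, and $\sigma(\cdot)$ is the spectrum.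
   Formalization: (2) fails as printed (U=I: −1 is not in σ(T); sign −: eigenvalues are negated). With ε=±1 the sign in (1), it is proved that σ(T)={ε(a±‖ξ‖)}∪{±1} if U≠±I on ⟨ξ⟩^⊥, with {±1} replaced by {ε} if U=I there and by {−ε} if U=−I there. *)

theory Defs
  imports "HOL-Analysis.Analysis"
begin

text \<open>
  Complex Hilbert spaces as a type class on top of the real normed spaces of the library.
  The inner product is linear in its \<^emph>\<open>first\<close> argument.
\<close>

class complex_vector = real_vector +
  fixes scaleC :: "complex \<Rightarrow> 'a \<Rightarrow> 'a" (infixr \<open>*\<^sub>C\<close> 75)
  assumes scaleC_add_right: "c *\<^sub>C (x + y) = c *\<^sub>C x + c *\<^sub>C y"
    and scaleC_add_left: "(c + d) *\<^sub>C x = c *\<^sub>C x + d *\<^sub>C x"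
    and scaleC_scaleC: "c *\<^sub>C (d *\<^sub>C x) = (c * d) *\<^sub>C x"
    and scaleR_scaleC: "r *\<^sub>R x = complex_of_real r *\<^sub>C x"

class complex_inner = complex_vector + real_normed_vector +
  fixes cinner :: "'a \<Rightarrow> 'a \<Rightarrow> complex"
  assumes cinner_commute: "cinner x y = cnj (cinner y x)"
    and cinner_add_left: "cinner (x + y) z = cinner x z + cinner y z"
    and cinner_scaleC_left: "cinner (c *\<^sub>C x) y = c * cinner x y"
    and cinner_ge_zero: "0 \<le> Re (cinner x x)"
    and cinner_eq_zero_iff: "cinner x x = 0 \<longleftrightarrow> x = 0"
    and norm_eq_sqrt_cinner: "norm x = sqrt (Re (cinner x x))"

class complex_hilbert_space = complex_inner + complete_space

lemma vector_space_scaleC: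
  "vector_space (scaleC :: complex \<Rightarrow> 'a \<Rightarrow> 'a::complex_vector)"
proof
  fix x :: 'a
  show "1 *\<^sub>C x = x"
    using scaleR_scaleC[of 1 x] by simp
qed (simp_all add: scaleC_add_right scaleC_add_left scaleC_scaleC)

lemma Re_cinner_self: "Re (cinner x x) = (norm x)\<^sup>2" for x :: "'a::complex_inner"
  by (simp add: norm_eq_sqrt_cinner cinner_ge_zero)

abbreviation cspan :: "'a::complex_vector set \<Rightarrow> 'a set"
  where "cspan \<equiv> module.span scaleC"

abbreviation clinear :: "('a::complex_vector \<Rightarrow> 'b::complex_vector) \<Rightarrow> bool"
  where "clinear \<equiv> Vector_Spaces.linear scaleC scaleC"

instantiation complex :: complex_hilbert_space
begin

definition scaleC_complex :: "complex \<Rightarrow> complex \<Rightarrow> complex"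
  where "scaleC_complex c z = c * z"

definition cinner_complex :: "complex \<Rightarrow> complex \<Rightarrow> complex"
  where "cinner_complex z w = z * cnj w"

instance
proof
  fix z :: complex
  show "norm z = sqrt (Re (cinner z z))"
    by (simp add: cinner_complex_def complex_norm_square[symmetric] cmod_def power2_eq_square)
qed (auto simp: scaleC_complex_def cinner_complex_def algebra_simps scaleR_conv_of_real)

end

text \<open>
  The Hilbert space direct sum, carried by the product type. The library's norm on
  products is already the Euclidean one.
\<close>

instantiation prod :: (complex_hilbert_space, complex_hilbert_space) complex_hilbert_space
begin

definition scaleC_prod :: "complex \<Rightarrow> 'a \<times> 'b \<Rightarrow> 'a \<times> 'b"
  where "scaleC_prod c u = (c *\<^sub>C fst u, c *\<^sub>C snd u)"

definition cinner_prod :: "'a \<times> 'b \<Rightarrow> 'a \<times> 'b \<Rightarrow> complex"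
  where "cinner_prod u v = cinner (fst u) (fst v) + cinner (snd u) (snd v)"

instance
proof
  fix u v w :: "'a \<times> 'b" and c d :: complex and r :: real
  show "c *\<^sub>C (u + v) = c *\<^sub>C u + c *\<^sub>C v"
    by (simp add: scaleC_prod_def scaleC_add_right)
  show "(c + d) *\<^sub>C u = c *\<^sub>C u + d *\<^sub>C u"
    by (simp add: scaleC_prod_def scaleC_add_left)
  show "c *\<^sub>C (d *\<^sub>C u) = (c * d) *\<^sub>C u"
    by (simp add: scaleC_prod_def scaleC_scaleC)
  show "r *\<^sub>R u = complex_of_real r *\<^sub>C u"
    by (simp add: scaleC_prod_def scaleR_prod_def scaleR_scaleC)
  show "cinner u v = cnj (cinner v u)"
    using cinner_commute[of "fst u" "fst v"] cinner_commute[of "snd u" "snd v"]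
    by (simp add: cinner_prod_def)
  show "cinner (u + v) w = cinner u w + cinner v w"
    by (simp add: cinner_prod_def cinner_add_left)
  show "cinner (c *\<^sub>C u) v = c * cinner u v"
    by (simp add: cinner_prod_def scaleC_prod_def cinner_scaleC_left algebra_simps)
  show "0 \<le> Re (cinner u u)"
    by (simp add: cinner_prod_def cinner_ge_zero)
  show nrm: "norm u = sqrt (Re (cinner u u))"
    by (simp add: cinner_prod_def norm_prod_def Re_cinner_self)
  show "cinner u u = 0 \<longleftrightarrow> u = 0"
  proof
    assume "cinner u u = 0"
    then show "u = 0" using nrm by simp
  next
    assume "u = 0"
    then show "cinner u u = 0"
      using cinner_eq_zero_iff[of "0::'a"] cinner_eq_zero_iff[of "0::'b"]
      by (simp add: cinner_prod_def)
  qed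
qed

end

definition infinite_dimensional :: "'a::complex_vector itself \<Rightarrow> bool"
  where "infinite_dimensional _ \<longleftrightarrow> \<not> (\<exists>B :: 'a set. finite B \<and> cspan B = UNIV)"

definition orthogonal_complement :: "'a::complex_inner set \<Rightarrow> 'a set"
  where "orthogonal_complement S = {x. \<forall>y\<in>S. cinner x y = 0}"

definition bounded_clinear :: "('a::complex_inner \<Rightarrow> 'b::complex_inner) \<Rightarrow> bool"
  where "bounded_clinear T \<longleftrightarrow> clinear T \<and> bounded_linear T"

definition self_adjoint :: "('a::complex_hilbert_space \<Rightarrow> 'a) \<Rightarrow> bool"
  where "self_adjoint T \<longleftrightarrow>
    bounded_clinear T \<and> (\<forall>x y. cinner (T x) y = cinner x (T y))"

definition positive_operator :: "('a::complex_hilbert_space \<Rightarrow> 'a) \<Rightarrow> bool"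
  where "positive_operator A \<longleftrightarrow>
    bounded_clinear A \<and> (\<forall>x. cinner (A x) x \<in> \<real> \<and> 0 \<le> Re (cinner (A x) x))"

definition unitary_operator :: "('a::complex_hilbert_space \<Rightarrow> 'a) \<Rightarrow> bool"
  where "unitary_operator U \<longleftrightarrow>
    clinear U \<and> bij U \<and> (\<forall>x y. cinner (U x) (U y) = cinner x y)"

definition involutory :: "('a \<Rightarrow> 'a) \<Rightarrow> bool"
  where "involutory U \<longleftrightarrow> U \<circ> U = id"

definition spectrum :: "('a::complex_hilbert_space \<Rightarrow> 'a) \<Rightarrow> complex set"
  where "spectrum T = {l. \<not> (\<exists>S. bounded_clinear S \<and>
    (\<forall>x. S (T x - l *\<^sub>C x) = x) \<and> (\<forall>x. T (S x) - l *\<^sub>C S x = x))}"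

definition form_A :: "'h::complex_hilbert_space \<times> complex \<Rightarrow> 'h \<times> complex \<Rightarrow> complex"
  where "form_A u v = cinner (fst u) (fst v) - snd u * cnj (snd v)"

definition group_G :: "('h::complex_hilbert_space \<times> complex \<Rightarrow> 'h \<times> complex) set"
  where "group_G = {T. clinear T \<and> bij T \<and> (\<forall>u v. form_A (T u) (T v) = form_A u v)}"

text \<open>
  \<open>block P \<eta> \<zeta> c\<close> is the block matrix with rows \<open>P, \<eta>\<close> and \<open>\<langle>\<cdot>, \<zeta>\<rangle>, c\<close>.
\<close>

definition block ::
  "('h::complex_hilbert_space \<Rightarrow> 'h) \<Rightarrow> 'h \<Rightarrow> 'h \<Rightarrow> complex \<Rightarrow> 'h \<times> complex \<Rightarrow> 'h \<times> complex"
  where "block P \<eta> \<zeta> c = (\<lambda>(x, z). (P x + z *\<^sub>C \<eta>, cinner x \<zeta> + c * z))"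

end

theory Submission
  imports Defs
begin

text \<open>
  Self-adjointness at \<open>((0, 1), (0, 1))\<close> makes the scalar \<open>e\<^sup>i\<^sup>\<theta>\<close> real, and at
  \<open>((x, 0), (0, 1))\<close> it gives \<open>U \<xi> = \<xi>\<close>. Hence \<open>U\<close> preserves the orthogonal complement of \<open>\<xi>\<close>, where
  it is both unitary and self-adjoint, so \<open>U\<^sup>2 = 1\<close>.
  The space is then spanned by eigenvectors of \<open>T\<close>: the vectors \<open>(\<xi>, \<plusminus>\<parallel>\<xi>\<parallel>)\<close>
  and \<open>(y \<plusminus> U y, 0)\<close> with \<open>y\<close> orthogonal to \<open>\<xi>\<close>. An operator whose eigenvectors for finitely many
  eigenvalues span the space algebraically has no further spectrum, because Lagrange interpolation
  yields the resolvent as a polynomial in the operator.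
\<close>

section \<open>Complex linear maps and the inner product\<close>

interpretation complex_vector: vector_space "scaleC :: complex \<Rightarrow> 'a \<Rightarrow> 'a::complex_vector"
  by (rule vector_space_scaleC)

lemma clinearI:
  fixes f :: "'a::complex_vector \<Rightarrow> 'b::complex_vector"
  assumes "\<And>x y. f (x + y) = f x + f y" and "\<And>c x. f (c *\<^sub>C x) = c *\<^sub>C f x"
  shows "clinear f"
  using assms by (simp add: Vector_Spaces.linear_iff vector_space_scaleC)

lemma
  fixes f :: "'a::complex_vector \<Rightarrow> 'b::complex_vector"
  assumes "clinear f"
  shows clinear_add: "f (x + y) = f x + f y"
    and clinear_scaleC: "f (c *\<^sub>C x) = c *\<^sub>C f x"
    and clinear_diff: "f (x - y) = f x - f y"
    and clinear_zero: "f 0 = 0"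
proof -
  have "module_hom scaleC scaleC f"
    using assms by (simp add: Vector_Spaces.linear_def)
  then show "f (x + y) = f x + f y" "f (c *\<^sub>C x) = c *\<^sub>C f x" "f (x - y) = f x - f y" "f 0 = 0"
    by (rule module_hom.add module_hom.scale module_hom.diff module_hom.zero)+
qed

lemma cinner_zero_left [simp]: "cinner 0 x = 0"
  using cinner_add_left[of 0 0 x] by simp

lemma cinner_zero_right [simp]: "cinner x 0 = 0"
  using cinner_commute[of x 0] by simp

lemma cinner_diff_left: "cinner (x - y) z = cinner x z - cinner y z"
  using cinner_add_left[of "x - y" y z] by simp

lemma cinner_add_right: "cinner x (y + z) = cinner x y + cinner x z"
  by (simp add: cinner_commute[of x] cinner_add_left)

lemma cinner_diff_right: "cinner x (y - z) = cinner x y - cinner x z"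
  by (simp add: cinner_commute[of x] cinner_diff_left)

lemma cinner_scaleC_right: "cinner x (c *\<^sub>C y) = cnj c * cinner x y"
  by (simp add: cinner_commute[of x] cinner_scaleC_left)

lemma cinner_self: "cinner x x = complex_of_real ((norm x)\<^sup>2)"
proof -
  have "cnj (cinner x x) = cinner x x"
    using cinner_commute[of x x] by simp
  then have "Im (cinner x x) = 0"
    by (simp add: complex_eq_iff)
  then show ?thesis
    using Re_cinner_self[of x] by (simp add: complex_eq_iff)
qed

text \<open>The class relates the norm to real scalars only; for complex ones it is recovered by
  comparing squares through \<open>cinner\<close>. This makes complex scaling a bounded
  operation.\<close>

lemma norm_scaleC: "norm (c *\<^sub>C x) = cmod c * norm x" for x :: "'a::complex_inner"
proof -
  have "(complex_of_real (norm (c *\<^sub>C x)))\<^sup>2 = (complex_of_real (cmod c * norm x))\<^sup>2"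
    using cinner_self[of "c *\<^sub>C x"] cinner_self[of x] complex_norm_square[of c]
    by (simp add: cinner_scaleC_left cinner_scaleC_right power_mult_distrib mult_ac)
  then have "(norm (c *\<^sub>C x))\<^sup>2 = (cmod c * norm x)\<^sup>2"
    by (simp only: of_real_power[symmetric] of_real_eq_iff)
  then show ?thesis
    by simp
qed

section \<open>Orthogonality to a single vector\<close>

lemma mem_orthogonal_complement_cspan_singleton:
  "x \<in> orthogonal_complement (cspan {y}) \<longleftrightarrow> cinner x y = 0"
proof -
  have "y \<in> cspan {y}"
    by (simp add: complex_vector.span_base)
  then show ?thesis
    by (auto simp: orthogonal_complement_def complex_vector.span_singleton cinner_scaleC_right)
qed

lemma orthogonal_decomposition:
  fixes x y :: "'a::complex_inner"
  assumes "y \<noteq> 0"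
  obtains k w where "x = w + k *\<^sub>C y" and "cinner w y = 0"
proof
  show "x = (x - (cinner x y / cinner y y) *\<^sub>C y) + (cinner x y / cinner y y) *\<^sub>C y"
    by simp
  show "cinner (x - (cinner x y / cinner y y) *\<^sub>C y) y = 0"
    using assms by (simp add: cinner_diff_left cinner_scaleC_left cinner_eq_zero_iff)
qed

text \<open>Infinite dimension enters here: it guarantees an eigenvector of \<open>U\<close>
  orthogonal to \<open>\<xi>\<close> when \<open>U\<close> acts there as a scalar.\<close>

lemma exists_nonzero_orthogonal:
  fixes y :: "'a::complex_inner"
  assumes "infinite_dimensional TYPE('a)"
  obtains w :: 'a where "w \<noteq> 0" and "cinner w y = 0"
proof (cases "y = 0")
  case True
  have "\<exists>w :: 'a. w \<noteq> 0"
  proof (rule ccontr)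
    assume "\<not> (\<exists>w :: 'a. w \<noteq> 0)"
    then have "cspan {} = (UNIV :: 'a set)"
      by auto
    with assms show False
      unfolding infinite_dimensional_def by blast
  qed
  with True that show ?thesis
    by auto
next
  case False
  \<comment> \<open>A line is not the whole space, and a vector off the line has a nonzero
    orthogonal component.\<close>
  have "cspan {y} \<noteq> UNIV"
    using assms unfolding infinite_dimensional_def by blast
  then obtain x where x: "x \<notin> cspan {y}"
    by blast
  obtain k w where w: "x = w + k *\<^sub>C y" "cinner w y = 0"
    using orthogonal_decomposition[OF False] .
  with x have "w \<noteq> 0"
    by (auto simp: complex_vector.span_singleton)
  with w that show ?thesis
    by blast
qed

section \<open>Closure properties of bounded operators\<close>

lemma bounded_clinear_id: "bounded_clinear (\<lambda>x :: 'a::complex_inner. x)"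
  by (simp add: bounded_clinear_def bounded_linear_ident clinearI)

lemma bounded_clinear_add:
  "bounded_clinear f \<Longrightarrow> bounded_clinear g \<Longrightarrow> bounded_clinear (\<lambda>x. f x + g x)"
  by (auto simp: bounded_clinear_def clinear_add clinear_scaleC scaleC_add_right
      intro!: bounded_linear_add clinearI)

lemma bounded_clinear_scaleC:
  assumes "bounded_clinear f"
  shows "bounded_clinear (\<lambda>x. c *\<^sub>C f x)"
proof -
  have "bounded_linear (\<lambda>x :: 'b. c *\<^sub>C x)"
    by (rule bounded_linear_intro[where K = "cmod c"])
      (simp_all add: scaleC_add_right scaleR_scaleC scaleC_scaleC norm_scaleC mult.commute)
  from bounded_linear_compose[OF this] assms show ?thesis
    by (auto simp: bounded_clinear_def clinear_add clinear_scaleC scaleC_add_right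
      scaleC_scaleC mult.commute intro!: clinearI)
qed

lemma bounded_clinear_diff:
  assumes "bounded_clinear f" and "bounded_clinear g"
  shows "bounded_clinear (\<lambda>x. f x - g x)"
  using bounded_clinear_add[OF assms(1) bounded_clinear_scaleC[OF assms(2), of "-1"]]
  by simp

lemma bounded_clinear_compose:
  "bounded_clinear f \<Longrightarrow> bounded_clinear g \<Longrightarrow> bounded_clinear (\<lambda>x. f (g x))"
  by (auto simp: bounded_clinear_def clinear_add clinear_scaleC
      intro!: bounded_linear_compose[of f g] clinearI)

section \<open>Spectrum and eigenvectors\<close>

lemma eigenvalue_in_spectrum:
  assumes "T v = l *\<^sub>C v" and "v \<noteq> 0"
  shows "l \<in> spectrum T"
proof -
  have False if "bounded_clinear S" and "\<forall>x. S (T x - l *\<^sub>C x) = x" for S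
  proof -
    \<comment> \<open>A left inverse of \<open>T - l\<close> would recover \<open>v\<close> from 0,
      which linearity forbids.\<close>
    have "S 0 = v"
      using that(2)[rule_format, of v] assms(1) by simp
    with that(1) assms(2) show False
      by (simp add: bounded_clinear_def clinear_zero)
  qed
  then show ?thesis
    by (auto simp: spectrum_def)
qed

text \<open>The witness \<open>Q\<close> is a polynomial \<open>q\<close> in \<open>T\<close> that interpolates \<open>1 / (k - l)\<close> at \<open>k \<in> L\<close>.\<close>

lemma interpolating_resolvent:
  fixes T :: "'a::complex_inner \<Rightarrow> 'a"
  assumes "finite L" and "bounded_clinear T" and "l \<notin> L"
  shows "\<exists>Q q. bounded_clinear Q \<and> (\<forall>k v. T v = k *\<^sub>C v \<longrightarrow> Q v = q k *\<^sub>C v) \<and>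
    (\<forall>k\<in>L. q k * (k - l) = 1)"
  using assms(1,3)
proof (induction L)
  case empty
  have "bounded_clinear (\<lambda>x :: 'a. 1 *\<^sub>C x)"
    by (rule bounded_clinear_scaleC[OF bounded_clinear_id])
  then show ?case
    \<comment> \<open>Without nodes any polynomial serves; the constant 1 is taken.\<close>
    by (intro exI[of _ "\<lambda>x. 1 *\<^sub>C x"] exI[of _ "\<lambda>_. 1"]) simp
next
  case (insert m L)
  then obtain Q q where Q: "bounded_clinear Q" "\<And>k v. T v = k *\<^sub>C v \<Longrightarrow> Q v = q k *\<^sub>C v"
    and q: "\<And>k. k \<in> L \<Longrightarrow> q k * (k - l) = 1"
    by (metis insertI2)
  have ml: "m - l \<noteq> 0"
    using insert.prems by auto
  define \<alpha> where "\<alpha> = 1 / (m - l)"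
  \<comment> \<open>The correction has the factor \<open>1 - q k * (k - l)\<close>, which vanishes
    at the old nodes. At \<open>m\<close> the choice of \<open>\<alpha>\<close> makes it supply
    exactly what is missing, whatever \<open>q m\<close> was.\<close>
  define Q' where "Q' x = Q x + \<alpha> *\<^sub>C (x - Q (T x - l *\<^sub>C x))" for x
  define q' where "q' k = q k + \<alpha> * (1 - q k * (k - l))" for k
  have "bounded_clinear Q'"
    unfolding Q'_def
    by (intro bounded_clinear_add bounded_clinear_scaleC bounded_clinear_diff bounded_clinear_id
        bounded_clinear_compose[OF Q(1)] Q(1) assms(2))
  moreover have "Q' v = q' k *\<^sub>C v" if "T v = k *\<^sub>C v" for k v
  proof -
    have "Q (T v - l *\<^sub>C v) = Q ((k - l) *\<^sub>C v)"
      by (simp add: that complex_vector.scale_left_diff_distrib)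
    also have "\<dots> = (q k * (k - l)) *\<^sub>C v"
      using Q(1) Q(2)[OF that] by (simp add: bounded_clinear_def clinear_scaleC mult.commute)
    \<comment> \<open>The scalar 1 stays explicit so that all terms can be collected into one
      multiple of \<open>v\<close>.\<close>
    finally have "Q' v = q k *\<^sub>C v + \<alpha> *\<^sub>C (1 *\<^sub>C v - (q k * (k - l)) *\<^sub>C v)"
      by (simp add: Q'_def Q(2)[OF that])
    then show ?thesis
      by (simp only: q'_def complex_vector.scale_left_diff_distrib[symmetric]
          scaleC_add_left[symmetric] scaleC_scaleC)
  qed
  moreover have "q' k * (k - l) = 1" if "k \<in> insert m L" for k
  proof (cases "k \<in> L")
    case True
    then show ?thesis
      using q[of k] by (simp add: q'_def)
  next
    case False
    with that have "k = m"
      by simp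
    have "q' m * (m - l) = q m * (m - l) + (\<alpha> * (m - l)) * (1 - q m * (m - l))"
      by (simp add: q'_def algebra_simps)
    also have "\<alpha> * (m - l) = 1"
      using ml by (simp add: \<alpha>_def)
    finally show ?thesis
      using \<open>k = m\<close> by simp
  qed
  ultimately show ?case
    by blast
qed

text \<open>Spans are algebraic, so linearity suffices and no continuity argument enters. It carries
  the resolvent identities from eigenvectors to the whole space.\<close>

lemma clinear_eq_id_on_cspan:
  assumes "clinear f" and "\<And>v. v \<in> B \<Longrightarrow> f v = v" and "x \<in> cspan B"
  shows "f x = x"
  using assms(3)
proof (induction rule: complex_vector.span_induct_alt)
  case base
  show ?case
    using assms(1) by (rule clinear_zero)
next
  case (step c v y)
  with assms(1,2) show ?case
    by (simp add: clinear_add clinear_scaleC)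
qed

text \<open>For \<open>l\<close> outside \<open>L\<close>, the interpolating operator inverts
  \<open>T - l\<close> on both sides at each eigenvector, hence everywhere; it is bounded, being a
  polynomial in \<open>T\<close>.\<close>

lemma spectrum_subset_eigenvalues:
  fixes T :: "'a::complex_hilbert_space \<Rightarrow> 'a"
  assumes "finite L" and "bounded_clinear T"
    and "cspan {v. \<exists>k\<in>L. T v = k *\<^sub>C v} = UNIV"
  shows "spectrum T \<subseteq> L"
proof
  fix l
  assume l: "l \<in> spectrum T"
  show "l \<in> L"
  proof (rule ccontr)
    assume "l \<notin> L"
    then obtain Q q where Q: "bounded_clinear Q" "\<And>k v. T v = k *\<^sub>C v \<Longrightarrow> Q v = q k *\<^sub>C v"
      and q: "\<And>k. k \<in> L \<Longrightarrow> q k * (k - l) = 1"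
      using interpolating_resolvent[OF assms(1,2)] by metis
    have T: "clinear T" and Ql: "clinear Q"
      using assms(2) Q(1) by (auto simp: bounded_clinear_def)
    have "bounded_clinear (\<lambda>x. Q (T x - l *\<^sub>C x))" and "bounded_clinear (\<lambda>x. T (Q x) - l *\<^sub>C Q x)"
      by (intro bounded_clinear_compose[OF Q(1)] bounded_clinear_compose[OF assms(2)]
          bounded_clinear_diff bounded_clinear_scaleC bounded_clinear_id assms(2) Q(1))+
    then have lin: "clinear (\<lambda>x. Q (T x - l *\<^sub>C x))" "clinear (\<lambda>x. T (Q x) - l *\<^sub>C Q x)"
      by (auto simp: bounded_clinear_def)
    have "Q (T v - l *\<^sub>C v) = v \<and> T (Q v) - l *\<^sub>C Q v = v" if "k \<in> L" "T v = k *\<^sub>C v" for k v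
    proof
      have "Q (T v - l *\<^sub>C v) = (q k * (k - l)) *\<^sub>C v"
        by (simp add: that(2) complex_vector.scale_left_diff_distrib[symmetric]
            clinear_scaleC[OF Ql] Q(2)[OF that(2)] mult.commute)
      with q[OF that(1)] show "Q (T v - l *\<^sub>C v) = v"
        by simp
      have "T (Q v) - l *\<^sub>C Q v = (q k * (k - l)) *\<^sub>C v"
        by (simp add: that(2) clinear_scaleC[OF T] Q(2)[OF that(2)] right_diff_distrib
            complex_vector.scale_left_diff_distrib mult.commute)
      with q[OF that(1)] show "T (Q v) - l *\<^sub>C Q v = v"
        by simp
    qed
    then have E: "Q (T v - l *\<^sub>C v) = v" "T (Q v) - l *\<^sub>C Q v = v"
      if "v \<in> {v. \<exists>k\<in>L. T v = k *\<^sub>C v}" for v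
      using that by blast+
    have "Q (T x - l *\<^sub>C x) = x" "T (Q x) - l *\<^sub>C Q x = x" for x
      using clinear_eq_id_on_cspan[OF lin(1) E(1)] clinear_eq_id_on_cspan[OF lin(2) E(2)]
        assms(3) by blast+
    with Q(1) l show False
      by (auto simp: spectrum_def)
  qed
qed

lemma spectrum_eq_eigenvalues:
  fixes T :: "'a::complex_hilbert_space \<Rightarrow> 'a"
  assumes "finite L" and "bounded_clinear T"
    and "cspan {v. \<exists>k\<in>L. T v = k *\<^sub>C v} = UNIV"
    and "\<And>k. k \<in> L \<Longrightarrow> \<exists>v. v \<noteq> 0 \<and> T v = k *\<^sub>C v"
  shows "spectrum T = L"
  using spectrum_subset_eigenvalues[OF assms(1-3)] assms(4) eigenvalue_in_spectrum by blast

text \<open>The sign \<open>\<epsilon>\<close> multiplies the eigenvalues as well, and on the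
  orthogonal complement of \<open>\<xi>\<close> the operator \<open>U\<close> may have only one of
  the eigenvalues 1 and -1; hence the three cases for the spectrum.\<close>

theorem proposition3p7:
  fixes T :: "'h::complex_hilbert_space \<times> complex \<Rightarrow> 'h \<times> complex"
    and U A :: "'h \<Rightarrow> 'h" and \<xi> :: 'h and \<theta> a :: real
  assumes "infinite_dimensional TYPE('h)"
    and "T \<in> group_G"
    and "self_adjoint T"
    and "\<xi> \<noteq> 0"
    and "a = sqrt (1 + (norm \<xi>)\<^sup>2)"
    and "unitary_operator U"
    and "positive_operator A"
    and "A \<xi> = complex_of_real a *\<^sub>C \<xi>"
    and "\<forall>x \<in> orthogonal_complement (cspan {\<xi>}). A x = x"
    and "T = (\<lambda>u. exp (\<i> * complex_of_real \<theta>) *\<^sub>C block (U \<circ> A) (U \<xi>) \<xi> (complex_of_real a) u)"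
  shows "\<exists>\<epsilon> \<in> {1, - 1 :: complex}.
    (T = (\<lambda>u. \<epsilon> *\<^sub>C block (U \<circ> A) \<xi> \<xi> (complex_of_real a) u) \<and>
       unitary_operator U \<and> involutory U) \<and>
    ((\<exists>x \<in> orthogonal_complement (cspan {\<xi>}). U x \<noteq> x) \<and>
     (\<exists>x \<in> orthogonal_complement (cspan {\<xi>}). U x \<noteq> - x) \<longrightarrow>
       spectrum T = {\<epsilon> * complex_of_real (a + norm \<xi>), \<epsilon> * complex_of_real (a - norm \<xi>)} \<union> {1, - 1}) \<and>
    ((\<forall>x \<in> orthogonal_complement (cspan {\<xi>}). U x = x) \<longrightarrow>
       spectrum T = {\<epsilon> * complex_of_real (a + norm \<xi>), \<epsilon> * complex_of_real (a - norm \<xi>)} \<union> {\<epsilon>}) \<and>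
    ((\<forall>x \<in> orthogonal_complement (cspan {\<xi>}). U x = - x) \<longrightarrow>
       spectrum T = {\<epsilon> * complex_of_real (a + norm \<xi>), \<epsilon> * complex_of_real (a - norm \<xi>)} \<union> {- \<epsilon>})"
proof -
  let ?P = "orthogonal_complement (cspan {\<xi>})"
  define n where "n = norm \<xi>"
  define e where "e = exp (\<i> * complex_of_real \<theta>)"
  have n: "n > 0"
    using assms(4) by (simp add: n_def)
  have a: "a > 0"
    using assms(5) by (simp add: add_pos_nonneg)
  have \<xi>\<xi>: "cinner \<xi> \<xi> = complex_of_real (n\<^sup>2)"
    by (simp add: cinner_self n_def)
  have U: "clinear U" and UU: "\<And>x y. cinner (U x) (U y) = cinner x y"
    using assms(6) by (auto simp: unitary_operator_def)
  have A: "clinear A"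
    using assms(7) by (auto simp: positive_operator_def bounded_clinear_def)
  have AP: "A x = x" if "cinner x \<xi> = 0" for x
    using assms(9) that by (simp add: mem_orthogonal_complement_cspan_singleton)
  have T: "bounded_clinear T" and Tsa: "\<And>u v. cinner (T u) v = cinner u (T v)"
    using assms(3) by (auto simp: self_adjoint_def)
  have T_pair: "T (x, z) = (e *\<^sub>C (U (A x) + z *\<^sub>C U \<xi>), e * (cinner x \<xi> + complex_of_real a * z))"
    for x z
    by (simp add: assms(10) e_def block_def scaleC_prod_def scaleC_complex_def)
  have zero: "U 0 = 0" "A 0 = 0"
    using U A by (simp_all add: clinear_zero)

  \<comment> \<open>The scalar factor and the structure of \<open>U\<close>\<close>
  have "e * complex_of_real a = cnj e * complex_of_real a"
    using Tsa[of "(0, 1)" "(0, 1)"]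
    by (simp add: T_pair zero cinner_prod_def cinner_complex_def)
  then have e_real: "cnj e = e"
    using a by simp
  moreover have "e * cnj e = 1"
    using complex_norm_square[of e] by (simp add: e_def)
  ultimately have "e\<^sup>2 = 1"
    by (simp add: power2_eq_square)
  then have e: "e = 1 \<or> e = - 1"
    by (simp add: power2_eq_1_iff)
  then have e0: "e \<noteq> 0"
    by auto
  have "cinner x (U \<xi>) = cinner x \<xi>" for x
    using Tsa[of "(x, 0)" "(0, 1)"] e0
    by (simp add: T_pair zero cinner_prod_def cinner_complex_def cinner_scaleC_right e_real)
  \<comment> \<open>Take \<open>x\<close> to be \<open>U \<xi> - \<xi>\<close> itself.\<close>
  then have "cinner (U \<xi> - \<xi>) (U \<xi> - \<xi>) = 0"
    by (simp add: cinner_diff_right)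
  then have U\<xi>: "U \<xi> = \<xi>"
    by (simp add: cinner_eq_zero_iff)
  have U_perp: "cinner (U x) \<xi> = 0" if "cinner x \<xi> = 0" for x
    using UU[of x \<xi>] that U\<xi> by simp
  \<comment> \<open>On these vectors \<open>A\<close> is the identity, and the real nonzero factor
    \<open>e\<close> cancels.\<close>
  have U_sa: "cinner (U x) y = cinner x (U y)" if "cinner x \<xi> = 0" "cinner y \<xi> = 0" for x y
    using Tsa[of "(x, 0)" "(y, 0)"] e0 that
    by (simp add: T_pair AP cinner_prod_def cinner_complex_def cinner_scaleC_right
        cinner_scaleC_left e_real)
  have U_inv: "U (U x) = x" if x: "cinner x \<xi> = 0" for x
  proof -
    let ?d = "U (U x) - x"
    have d: "cinner ?d \<xi> = 0"
      by (simp add: cinner_diff_left U_perp x)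
    \<comment> \<open>Since \<open>?d\<close> is also orthogonal to \<open>\<xi>\<close>, one
      \<open>U\<close> can be moved across to it; unitarity then removes \<open>U\<close> from both
      sides.\<close>
    have "cinner (U (U x)) ?d = cinner x ?d"
      using U_sa[OF U_perp[OF x] d] UU by simp
    then have "cinner ?d ?d = 0"
      by (simp add: cinner_diff_left)
    then show ?thesis
      by (simp add: cinner_eq_zero_iff)
  qed
  have "U (U x) = x" for x
  proof -
    obtain k w where "x = w + k *\<^sub>C \<xi>" "cinner w \<xi> = 0"
      using orthogonal_decomposition[OF assms(4)] .
    then show ?thesis
      by (simp add: clinear_add[OF U] clinear_scaleC[OF U] U\<xi> U_inv)
  qed
  then have inv: "involutory U"
    by (auto simp: involutory_def)
  have T_block: "T = (\<lambda>u. e *\<^sub>C block (U \<circ> A) \<xi> \<xi> (complex_of_real a) u)"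
    by (simp add: assms(10) e_def U\<xi>)

  \<comment> \<open>Eigenvectors of \<open>T\<close>\<close>
  let ?p = "e * complex_of_real (a + n)" and ?m = "e * complex_of_real (a - n)"
  let ?c = "complex_of_real"
  \<comment> \<open>On the plane of \<open>\<xi>\<close> and the last coordinate, \<open>T\<close>
    is \<open>e\<close> times a 2 by 2 problem; its second row demands
    \<open>n\<^sup>2 + a s = (a + s) s\<close>, which holds for \<open>s = n\<close> and
    \<open>s = - n\<close>.\<close>
  have eig_\<xi>: "T (\<xi>, ?c s) = (e * ?c (a + s)) *\<^sub>C (\<xi>, ?c s)" if "s\<^sup>2 = n\<^sup>2" for s
  proof -
    have "?c (n\<^sup>2) + ?c a * ?c s = ?c (a + s) * ?c s"
      by (simp only: of_real_mult[symmetric] of_real_add[symmetric] that[symmetric])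
        (simp add: power2_eq_square algebra_simps)
    then show ?thesis
      by (simp add: T_pair assms(8) clinear_scaleC[OF U] U\<xi> \<xi>\<xi> scaleC_prod_def scaleC_complex_def
          scaleC_add_left distrib_left scaleC_add_right mult.assoc)
  qed
  have eig_p: "T (\<xi>, ?c n) = ?p *\<^sub>C (\<xi>, ?c n)" and eig_m: "T (\<xi>, - ?c n) = ?m *\<^sub>C (\<xi>, - ?c n)"
    using eig_\<xi>[of n] eig_\<xi>[of "- n"] by simp_all
  have T_perp: "T (y, 0) = (e * k) *\<^sub>C (y, 0)" if "cinner y \<xi> = 0" "U y = k *\<^sub>C y" for y k
    using that by (simp add: T_pair AP scaleC_prod_def scaleC_complex_def)
  \<comment> \<open>All cases at once: \<open>K\<close> is the set of eigenvalues of
    \<open>U\<close> on the orthogonal complement of \<open>\<xi>\<close>, where its eigenvectors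
    must span.\<close>
  have spec: "spectrum T = {?p, ?m} \<union> (\<lambda>k. e * k) ` K"
    if K: "finite K"
      and dec: "\<And>y. cinner y \<xi> = 0 \<Longrightarrow> y \<in> cspan {v. cinner v \<xi> = 0 \<and> (\<exists>k\<in>K. U v = k *\<^sub>C v)}"
      and ex: "\<And>k. k \<in> K \<Longrightarrow> \<exists>v. v \<noteq> 0 \<and> cinner v \<xi> = 0 \<and> U v = k *\<^sub>C v" for K
  proof (rule spectrum_eq_eigenvalues)
    let ?L = "{?p, ?m} \<union> (\<lambda>k. e * k) ` K"
    let ?E = "{v. \<exists>k\<in>?L. T v = k *\<^sub>C v}"
    show "finite ?L"
      using K by simp
    show "\<exists>v. v \<noteq> 0 \<and> T v = k *\<^sub>C v" if k: "k \<in> ?L" for k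
    proof -
      have \<xi>0: "(\<xi>, z) \<noteq> 0" for z :: complex
        using assms(4) by (simp add: zero_prod_def)
      consider "k = ?p" | "k = ?m" | j where "k = e * j" "j \<in> K"
        using k by auto
      then show ?thesis
      proof cases
        case 1
        then show ?thesis
          using eig_p \<xi>0 by blast
      next
        case 2
        then show ?thesis
          using eig_m \<xi>0 by blast
      next
        case 3
        then obtain v where "v \<noteq> 0" "cinner v \<xi> = 0" "U v = j *\<^sub>C v"
          using ex by blast
        then show ?thesis
          using T_perp[of v j] 3 by (intro exI[of _ "(v, 0)"]) (simp add: zero_prod_def)
      qed
    qed
    \<comment> \<open>The embedding of \<open>y\<close> as \<open>(y, 0)\<close> carries
      eigenvectors of \<open>U\<close> to eigenvectors of \<open>T\<close>.\<close>
    have perp: "(y, 0) \<in> cspan ?E" if "cinner y \<xi> = 0" for y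
      using dec[OF that]
    proof (induction rule: complex_vector.span_induct_alt)
      case base
      then show ?case
        using complex_vector.span_zero[of ?E] by (simp add: zero_prod_def)
    next
      case (step c v w)
      then obtain k where "k \<in> K" "T (v, 0) = (e * k) *\<^sub>C (v, 0)"
        using T_perp by blast
      then have "(v, 0) \<in> ?E"
        by blast
      from complex_vector.span_add[OF complex_vector.span_scale[OF complex_vector.span_base[OF this]]
          step.IH, of c]
      have "c *\<^sub>C (v, 0) + (w, 0) \<in> cspan ?E" .
      also have "c *\<^sub>C (v, 0) + (w, 0) = (c *\<^sub>C v + w, 0 :: complex)"
        by (simp add: scaleC_prod_def scaleC_complex_def)
      finally show ?case .
    qed
    have "(x, z) \<in> cspan ?E" for x z
    proof -
      obtain k w where w: "x = w + k *\<^sub>C \<xi>" "cinner w \<xi> = 0"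
        using orthogonal_decomposition[OF assms(4)] .
      \<comment> \<open>The solution of \<open>?c1 + ?c2 = k\<close> and
        \<open>(?c1 - ?c2) n = z\<close>, available because \<open>n\<close> is nonzero.\<close>
      let ?c1 = "(k + z / ?c n) / 2" and ?c2 = "(k - z / ?c n) / 2"
      have "(w, 0) + (?c1 *\<^sub>C (\<xi>, ?c n) + ?c2 *\<^sub>C (\<xi>, - ?c n)) \<in> cspan ?E"
      proof (intro complex_vector.span_add complex_vector.span_scale)
        show "(w, 0) \<in> cspan ?E"
          using perp[OF w(2)] .
        show "(\<xi>, ?c n) \<in> cspan ?E"
          using eig_p by (intro complex_vector.span_base) blast
        show "(\<xi>, - ?c n) \<in> cspan ?E"
          using eig_m by (intro complex_vector.span_base) blast
      qed
      moreover have "?c1 *\<^sub>C (\<xi>, ?c n) + ?c2 *\<^sub>C (\<xi>, - ?c n) = (k *\<^sub>C \<xi>, z)"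
      proof -
        have "?c1 + ?c2 = k" "?c1 * ?c n - ?c2 * ?c n = z"
          using n by (simp_all add: field_simps)
        then show ?thesis
          by (simp add: scaleC_prod_def scaleC_complex_def scaleC_add_left[symmetric])
      qed
      ultimately show ?thesis
        using w(1) by simp
    qed
    then show "cspan ?E = UNIV"
      by auto
  qed (rule T)

  \<comment> \<open>The three cases for the spectrum\<close>
  obtain w where w: "w \<noteq> 0" "cinner w \<xi> = 0"
    using exists_nonzero_orthogonal[OF assms(1)] .
  have spec1: "spectrum T = {?p, ?m} \<union> {1, - 1}"
    if "x \<in> ?P" "U x \<noteq> x" "x' \<in> ?P" "U x' \<noteq> - x'" for x x'
  proof -
    have x: "cinner x \<xi> = 0" "cinner x' \<xi> = 0"
      using that by (simp_all add: mem_orthogonal_complement_cspan_singleton)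
    \<comment> \<open>As \<open>U\<close> squares to the identity, these are its spectral components
      of \<open>y\<close>, up to the factor 2.\<close>
    have eig: "cinner (y + U y) \<xi> = 0 \<and> U (y + U y) = 1 *\<^sub>C (y + U y)"
      "cinner (y - U y) \<xi> = 0 \<and> U (y - U y) = (- 1) *\<^sub>C (y - U y)" if "cinner y \<xi> = 0" for y
      using that by (simp_all add: cinner_add_left cinner_diff_left U_perp clinear_add[OF U]
          clinear_diff[OF U] U_inv add.commute)
    have "spectrum T = {?p, ?m} \<union> (\<lambda>k. e * k) ` {1, - 1}"
    proof (rule spec)
      let ?B = "{v. cinner v \<xi> = 0 \<and> (\<exists>k\<in>{1, - 1}. U v = k *\<^sub>C v)}"
      fix y
      assume y: "cinner y \<xi> = 0"
      have "(1 / 2) *\<^sub>C (y + U y) + (1 / 2) *\<^sub>C (y - U y) \<in> cspan ?B"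
        using eig[OF y]
        by (intro complex_vector.span_add complex_vector.span_scale complex_vector.span_base) blast+
      also have "(1 / 2) *\<^sub>C (y + U y) + (1 / 2) *\<^sub>C (y - U y) = y"
        by (simp add: scaleC_add_right complex_vector.scale_right_diff_distrib
            scaleC_add_left[symmetric])
      finally show "y \<in> cspan ?B" .
    next
      fix k :: complex
      assume "k \<in> {1, - 1}"
      \<comment> \<open>The two case assumptions say exactly that each eigenvalue has a nonzero
        eigenvector: \<open>x'\<close> yields 1 and \<open>x\<close> yields -1.\<close>
      moreover have "x' + U x' \<noteq> 0" "x - U x \<noteq> 0"
        using that by (auto simp: add_eq_0_iff)
      ultimately show "\<exists>v. v \<noteq> 0 \<and> cinner v \<xi> = 0 \<and> U v = k *\<^sub>C v"
        using eig(1)[OF x(2)] eig(2)[OF x(1)] by blast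
    qed simp
    \<comment> \<open>The set is symmetric under sign change, so \<open>e\<close> drops out of this
      part of the spectrum.\<close>
    also have "(\<lambda>k. e * k) ` {1, - 1} = {1, - 1}"
      using e by auto
    finally show ?thesis .
  qed
  have spec2: "spectrum T = {?p, ?m} \<union> {e * k}" if "\<And>x. x \<in> ?P \<Longrightarrow> U x = k *\<^sub>C x" for k
  proof -
    have k: "U x = k *\<^sub>C x" if "cinner x \<xi> = 0" for x
      using \<open>\<And>x. x \<in> ?P \<Longrightarrow> U x = k *\<^sub>C x\<close> that
      by (simp add: mem_orthogonal_complement_cspan_singleton)
    \<comment> \<open>Every vector orthogonal to \<open>\<xi>\<close> is an eigenvector here, and
      \<open>w\<close> provides a nonzero one.\<close>
    have "spectrum T = {?p, ?m} \<union> (\<lambda>k. e * k) ` {k}"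
      using k w by (intro spec) (auto intro: complex_vector.span_base)
    then show ?thesis
      by simp
  qed
  show ?thesis
  proof (rule bexI[of _ e], intro conjI impI)
    show "e \<in> {1, - 1}"
      using e by simp
  qed (use T_block assms(6) inv spec1 spec2[of 1] spec2[of "- 1"] in \<open>auto simp: n_def\<close>)
qed

end
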